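(* Let $n \geq 4$ be an integer, set $$\bar{\lambda}(n) := \frac{1}{2}\,\frac{n-3}{\sqrt{n-2}},$$ and assume that $0 < \lambda \leq \bar{\lambda}(n)$. Let $$E := \{ (x,t) \in \mathbb{R}^{n+1} : x_1 > 0 \}.$$ Then $E$ is a minimizer of the relative perimeter in $\Omega_{\lambda}$; that is, for every set $F \subset \mathbb{R}^{n+1}$ of locally finite perimeter such that $E \Delta F \subset\subset B_R$ for some $R > 0$, one has $$P(E;\Omega_{\lambda} \cap B_R) \leq P(F;\Omega_{\lambda} \cap B_R).$$
   Context: Points of $\mathbb{R}^{n+1}$ are written $(x,t)$ with $x = (x_1,\dots,x_n) \in \mathbb{R}^n$ and $t \in \mathbb{R}$. For $\lambda > 0$, $\Omega_{\lambda}$ is the open circular cone $$\Omega_{\lambda} := \left\{ (x,t) \in \mathbb{R}^{n+1} : t > \lambda \sqrt{x_1^2 + \dots + x_n^2} \right\}.$$ For a measurable set $F \subset \mathbb{R}^{n+1}$ and a Borel set $U$, $P(F;U)$ denotes the relative perimeter of $F$ in $U$ (the total variation in $U$ of the distributional gradient of the indicator function of $F$). A measurable set $F \subset \mathbb{R}^{n+1}$ has locally finite perimeter if $P(F;U) < +\infty$ for every $U \subset\subset \mathbb{R}^{n+1}$. $B_R$ is the open ball of radius $R$ centered at the origin of $\mathbb{R}^{n+1}$, $E \Delta F$ is the symmetric difference, and $A \subset\subset B$ means that the closure of $A$ is compact and contained in $B$. *)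

theory Defs
  imports "HOL-Analysis.Analysis"
begin

definition compactly_contained :: "'a::topological_space set \<Rightarrow> 'a set \<Rightarrow> bool"  (infix "\<subset>\<subset>" 50)
  where "A \<subset>\<subset> B \<longleftrightarrow> compact (closure A) \<and> closure A \<subseteq> B"

definition divergence :: "('a::euclidean_space \<Rightarrow> 'a) \<Rightarrow> 'a \<Rightarrow> real"
  where "divergence \<phi> x = (\<Sum>b\<in>Basis. frechet_derivative \<phi> (at x) b \<bullet> b)"

text \<open>The admissible test fields: class \<open>C\<^sup>1\<close>, compactly supported in \<open>V\<close>, with values in the
  closed Euclidean unit ball.\<close>

definition test_fields :: "'a::euclidean_space set \<Rightarrow> ('a \<Rightarrow> 'a) set"
  where "test_fields V =
    {\<phi>. (\<forall>x. \<phi> differentiable (at x)) \<and>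
        (\<forall>b\<in>Basis. continuous_on UNIV (\<lambda>x. frechet_derivative \<phi> (at x) b)) \<and>
        {x. \<phi> x \<noteq> 0} \<subset>\<subset> V \<and>
        (\<forall>x. norm (\<phi> x) \<le> 1)}"

text \<open>Total variation in the open set \<open>V\<close> of the distributional gradient of the indicator
  function of \<open>F\<close>, by duality. It is \<open>\<infinity>\<close> if that gradient is not a finite measure on \<open>V\<close>.\<close>

definition variation :: "'a::euclidean_space set \<Rightarrow> 'a set \<Rightarrow> ereal"
  where "variation F V =
    (SUP \<phi>\<in>test_fields V. ereal (set_lebesgue_integral lebesgue F (divergence \<phi>)))"

text \<open>The extension from open sets to Borel sets is the usual one by outer regularity;
  see \<open>perimeter_open\<close> below.\<close>

definition perimeter :: "'a::euclidean_space set \<Rightarrow> 'a set \<Rightarrow> ereal"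
  where "perimeter F U = (INF V\<in>{V. open V \<and> U \<subseteq> V}. variation F V)"

lemma variation_mono: "V \<subseteq> W \<Longrightarrow> variation F V \<le> variation F W"
  unfolding variation_def
  by (rule SUP_subset_mono) (auto simp: test_fields_def compactly_contained_def)

lemma perimeter_open: "open U \<Longrightarrow> perimeter F U = variation F U"
  unfolding perimeter_def
  by (rule antisym) (auto intro!: INF_lower INF_greatest variation_mono)

definition locally_finite_perimeter :: "'a::euclidean_space set \<Rightarrow> bool"
  where "locally_finite_perimeter F \<longleftrightarrow>
    F \<in> sets lebesgue \<and> (\<forall>U\<in>sets borel. U \<subset>\<subset> UNIV \<longrightarrow> perimeter F U < \<infinity>)"

definition perimeter_minimizer :: "'a::euclidean_space set \<Rightarrow> 'a set \<Rightarrow> bool"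
  where "perimeter_minimizer \<Omega> E \<longleftrightarrow>
    (\<forall>F R. locally_finite_perimeter F \<longrightarrow> R > 0 \<longrightarrow> sym_diff E F \<subset>\<subset> ball 0 R \<longrightarrow>
      perimeter E (\<Omega> \<inter> ball 0 R) \<le> perimeter F (\<Omega> \<inter> ball 0 R))"

text \<open>Points \<open>(x, t)\<close> of \<open>\<real>\<^sup>n\<^sup>+\<^sup>1\<close> are elements of \<^typ>\<open>(real ^ 'n) \<times> real\<close> with
  \<open>n = CARD('n)\<close>; the norm of the product type is the Euclidean one.\<close>

definition circular_cone :: "real \<Rightarrow> ((real ^ 'n) \<times> real) set"
  where "circular_cone l = {(x, t). t > l * norm x}"

text \<open>The index type carries no distinguished first element, so the coordinate \<open>x\<^sub>1\<close> is
  \<open>x $ i\<close> for an arbitrary index \<open>i\<close>.\<close>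

definition half_space :: "'n \<Rightarrow> ((real ^ 'n) \<times> real) set"
  where "half_space i = {(x, t). x $ i > 0}"

definition lambda_bar :: "nat \<Rightarrow> real"
  where "lambda_bar n = 1 / 2 * ((real n - 3) / sqrt (real n - 2))"

end

theory Submission
  imports Defs
begin

text \<open>The half-space is calibrated. Put \<open>\<rho> = norm p\<close>, \<open>w = \<rho> + t\<close> and \<open>\<alpha> = (n - 3) / 2\<close>. The function
  \<open>w powr (- \<alpha>)\<close> is a positive harmonic function, hence a Jacobi field, of the hyperplane \<open>x\<^sub>1 = 0\<close> of
  dimension \<open>n\<close>, which suggests the field \<open>e\<^sub>1 + \<alpha> * x\<^sub>1 * \<nabla>w / w\<close>, normal to the level sets of
  \<open>x\<^sub>1 * w powr \<alpha>\<close>. With \<open>y = x\<^sub>1\<^sup>2 / (\<rho> * w)\<close> its squared norm is \<open>1 + 2 * \<alpha> * (1 + \<alpha>) * y\<close>, and the field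
  \<open>X\<close> obtained after multiplication by \<open>exp (- \<alpha> * (1 + \<alpha>) * y)\<close> has norm at most \<open>1\<close>, equals \<open>e\<^sub>1\<close>
  where \<open>x\<^sub>1 = 0\<close>, and its divergence has the sign of \<open>x\<^sub>1\<close>. The cone is \<open>{h > 0}\<close> for \<open>h = t - c * \<rho>\<close>
  with \<open>c = \<lambda> / sqrt (1 + \<lambda>\<^sup>2)\<close>, and the derivative of \<open>h\<close> along \<open>X\<close> is a positive multiple of
  \<open>(\<alpha> - c * (1 + \<alpha>)) * x\<^sub>1\<close>; the hypothesis on \<open>\<lambda>\<close> is exactly \<open>c * (1 + \<alpha>) \<le> \<alpha>\<close>. Hence
  multiplying \<open>X\<close> by a nondecreasing cutoff of \<open>h\<close>, which also removes the singularity at the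
  vertex, keeps the sign of the divergence, and \<open>- X\<close> times cutoffs is an admissible test field
  for which passing from \<open>E\<close> to \<open>F\<close> can only increase the integral of the divergence.\<close>

section \<open>Integrals of directional derivatives over half-spaces\<close>

lemma supported_derivative_eq_0:
  fixes g :: "'a::real_normed_vector \<Rightarrow> 'b::real_normed_vector"
  assumes "(g has_derivative g') (at x)" and "closed K" and "\<And>y. y \<notin> K \<Longrightarrow> g y = 0" and "x \<notin> K"
  shows "g' = (\<lambda>_. 0)"
proof -
  have "((\<lambda>_. 0) has_derivative g') (at x)"
    using assms by (intro has_derivative_transform_within_open[OF assms(1), of "- K"]) auto
  then show ?thesis
    by (rule has_derivative_unique) simp
qed

lemma integrable_continuous_compact_support:
  fixes f :: "'a::euclidean_space \<Rightarrow> real"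
  assumes "continuous_on UNIV f" and "compact K" and "\<And>x. x \<notin> K \<Longrightarrow> f x = 0"
  shows "integrable lborel f"
proof -
  have "integrable lborel (\<lambda>x. indicator K x *\<^sub>R f x)"
    using assms by (intro borel_integrable_compact) (auto intro: continuous_on_subset)
  also have "(\<lambda>x. indicator K x *\<^sub>R f x) = f"
    using assms(3) by (auto simp: fun_eq_iff indicator_def)
  finally show ?thesis .
qed

lemma bounded_continuous_compact_support:
  fixes f :: "'a::topological_space \<Rightarrow> real"
  assumes "continuous_on UNIV f" and "compact K" and "\<And>x. x \<notin> K \<Longrightarrow> f x = 0"
  obtains M where "M \<ge> 0" and "\<And>x. \<bar>f x\<bar> \<le> M"
proof -
  have "bounded (f ` K)"
    using assms by (intro compact_imp_bounded compact_continuous_image) (auto intro: continuous_on_subset)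
  then obtain M where M: "\<And>x. x \<in> K \<Longrightarrow> \<bar>f x\<bar> \<le> M"
    by (auto simp: bounded_iff)
  show thesis
  proof
    show "\<bar>f x\<bar> \<le> max M 0" for x
      using M[of x] assms(3)[of x] by (cases "x \<in> K") auto
  qed simp
qed

lemma mvt_segment:
  fixes g :: "'a::real_normed_vector \<Rightarrow> real"
  assumes "\<And>x. (g has_derivative g' x) (at x)" and "0 \<le> t"
  obtains s where "s \<in> {0..t}" and "g (x + t *\<^sub>R b) - g x = t * g' (x + s *\<^sub>R b) b"
proof -
  have lin: "linear (g' x)" for x
    using assms(1) by (rule has_derivative_linear)
  have "((\<lambda>s. g (x + s *\<^sub>R b)) has_derivative (\<lambda>h. h * g' (x + s *\<^sub>R b) b)) (at s within {0..t})" for s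
  proof -
    have "((\<lambda>s. g (x + s *\<^sub>R b)) has_derivative (\<lambda>h. g' (x + s *\<^sub>R b) (h *\<^sub>R b))) (at s within {0..t})"
      by (rule has_derivative_compose[OF _ assms(1)]) (auto intro!: derivative_eq_intros)
    then show ?thesis
      by (simp add: linear_scale[OF lin])
  qed
  from mvt_very_simple[OF assms(2) this] that show thesis
    by auto
qed

lemma integral_lborel_shift:
  fixes f :: "'a::euclidean_space \<Rightarrow> real"
  assumes [measurable]: "f \<in> borel_measurable borel"
  shows "(\<integral>x. f (c + x) \<partial>lborel) = integral\<^sup>L lborel f"
proof -
  have "integral\<^sup>L lborel f = integral\<^sup>L (distr lborel borel ((+) c)) f"
    by (simp add: lborel_distr_plus)
  also have "\<dots> = (\<integral>x. f (c + x) \<partial>lborel)"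
    by (rule integral_distr) auto
  finally show ?thesis ..
qed

text \<open>Dominated convergence applies to the difference quotients of \<open>g\<close> along
  \<open>b\<close>, and translation invariance then moves the differencing onto the indicator of
  \<open>E\<close>. This is integration by parts for a Borel set, phrased without surface
  measures.\<close>

lemma set_integral_directional_derivative:
  fixes g :: "'a::euclidean_space \<Rightarrow> real"
  assumes g: "\<And>x. (g has_derivative g' x) (at x)"
    and cont: "continuous_on UNIV (\<lambda>x. g' x b)"
    and K: "compact K" "\<And>x. x \<notin> K \<Longrightarrow> g x = 0"
    and [measurable]: "E \<in> sets borel"
  shows "(\<lambda>n. \<integral>x. real (Suc n) * (indicator E (x - (1 / real (Suc n)) *\<^sub>R b) - indicator E x) * g x \<partial>lborel)
    \<longlonglongrightarrow> (\<integral>x. indicator E x * g' x b \<partial>lborel)"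
proof -
  have gc: "continuous_on UNIV g"
    using g by (meson has_derivative_continuous continuous_at_imp_continuous_on)
  have [measurable]: "g \<in> borel_measurable borel" "(\<lambda>x. g' x b) \<in> borel_measurable borel"
    using gc cont by (auto intro: borel_measurable_continuous_onI)
  have g'0: "g' x b = 0" if "x \<notin> K" for x
    using supported_derivative_eq_0[OF g compact_imp_closed[OF K(1)] K(2) that] by simp
  obtain M where M: "M \<ge> 0" "\<And>x. \<bar>g' x b\<bar> \<le> M"
    using bounded_continuous_compact_support[OF cont K(1) g'0] by blast
  \<comment> \<open>The steps \<open>1 / real (Suc n)\<close> are at most 1, so this set, swept out
    by translating \<open>K\<close> along \<open>- b\<close>, supports every difference quotient.
    Being compact, it yields the integrable majorant \<open>M * indicator L\<close>.\<close>
  define L where "L = (\<lambda>(x, t). x - t *\<^sub>R b) ` (K \<times> {0..1::real})"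
  have L: "compact L"
    unfolding L_def case_prod_beta
    by (intro compact_continuous_image compact_Times K continuous_intros compact_Icc)
  have inL: "x \<in> L" if "x + t *\<^sub>R b \<in> K" "0 \<le> t" "t \<le> 1" for x t
    unfolding L_def using that by (intro image_eqI[of _ _ "(x + t *\<^sub>R b, t)"]) auto
  define s where "s n x = indicator E x * (real (Suc n) * (g (x + (1 / real (Suc n)) *\<^sub>R b) - g x))" for n x
  have [measurable]: "s n \<in> borel_measurable borel" for n
    unfolding s_def[abs_def] by measurable
  have "(\<lambda>n. integral\<^sup>L lborel (s n)) \<longlonglongrightarrow> (\<integral>x. indicator E x * g' x b \<partial>lborel)"
  proof (rule integral_dominated_convergence[where w = "\<lambda>x. M * indicator L x"])
    show "integrable lborel (\<lambda>x. M * indicator L x)"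
      using emeasure_bounded_finite[OF compact_imp_bounded[OF L]] compact_imp_closed[OF L]
      by (intro integrable_mult_right integrable_real_indicator) auto
    show "AE x in lborel. (\<lambda>n. s n x) \<longlonglongrightarrow> indicator E x * g' x b"
    proof (intro AE_I2)
      fix x
      have lin: "linear (g' x)"
        using g by (rule has_derivative_linear)
      have "((\<lambda>t. g (x + t *\<^sub>R b)) has_derivative (\<lambda>h. g' (x + 0 *\<^sub>R b) (h *\<^sub>R b))) (at 0)"
        by (rule has_derivative_compose[OF _ g]) (auto intro!: derivative_eq_intros)
      then have "((\<lambda>t. g (x + t *\<^sub>R b)) has_real_derivative g' x b) (at 0)"
        by (simp add: has_field_derivative_def linear_scale[OF lin] mult.commute[of "g' x b"] mult_commute_abs)
      then have "((\<lambda>t. (g (x + t *\<^sub>R b) - g x) / t) \<longlongrightarrow> g' x b) (at 0)"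
        by (simp add: DERIV_def)
      moreover have "filterlim (\<lambda>n. 1 / real (Suc n)) (at 0) sequentially"
        unfolding filterlim_at using LIMSEQ_inverse_real_of_nat by (auto simp: inverse_eq_divide)
      ultimately have "(\<lambda>n. (g (x + (1 / real (Suc n)) *\<^sub>R b) - g x) / (1 / real (Suc n))) \<longlonglongrightarrow> g' x b"
        by (rule filterlim_compose)
      then show "(\<lambda>n. s n x) \<longlonglongrightarrow> indicator E x * g' x b"
        unfolding s_def by (intro tendsto_mult_left) (simp add: mult.commute)
    qed
    show "AE x in lborel. norm (s n x) \<le> M * indicator L x" for n
    proof (intro AE_I2)
      fix x
      define t where "t = 1 / real (Suc n)"
      have t: "0 < t" "t \<le> 1" by (auto simp: t_def)
      \<comment> \<open>A mean value point turns the quotient into a value of the derivative, hence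
        the bound \<open>M\<close> is uniform in \<open>n\<close>.\<close>
      obtain r where r: "r \<in> {0..t}" "g (x + t *\<^sub>R b) - g x = t * g' (x + r *\<^sub>R b) b"
        using mvt_segment[OF g] t by (metis less_eq_real_def)
      have s: "s n x = indicator E x * g' (x + r *\<^sub>R b) b"
        unfolding s_def t_def[symmetric] r(2) using t by (simp add: t_def)
      show "norm (s n x) \<le> M * indicator L x"
      proof (cases "x \<in> L")
        case True
        then show ?thesis using M(2)[of "x + r *\<^sub>R b"] M(1) by (auto simp: s indicator_def)
      next
        case False
        then have "x + r *\<^sub>R b \<notin> K" using inL[of x r] r t by auto
        then show ?thesis using False by (simp add: s g'0)
      qed
    qed
  qed auto
  \<comment> \<open>Discrete integration by parts: the shift is carried from \<open>g\<close> to the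
    indicator by a change of variables.\<close>
  moreover have "integral\<^sup>L lborel (s n) =
    (\<integral>x. real (Suc n) * (indicator E (x - (1 / real (Suc n)) *\<^sub>R b) - indicator E x) * g x \<partial>lborel)" for n
  proof -
    define t where "t = (1 / real (Suc n)) *\<^sub>R b"
    have gi: "integrable lborel g"
      by (rule integrable_continuous_compact_support[OF gc K])
    have gti: "integrable lborel (\<lambda>x. g (x + t))"
    proof (rule integrable_continuous_compact_support)
      show "compact ((\<lambda>x. x - t) ` K)"
        by (intro compact_continuous_image continuous_intros K)
      show "g (x + t) = 0" if "x \<notin> (\<lambda>x. x - t) ` K" for x
        using that by (intro K) (metis add_diff_cancel image_eqI)
    qed (auto intro!: continuous_intros continuous_on_compose2[OF gc])
    have ind: "integrable lborel (\<lambda>x. indicator A x * f x)" "integrable lborel (\<lambda>x. f x * indicator A x)"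
      if "A \<in> sets borel" "integrable lborel f" for A :: "'a set" and f :: "'a \<Rightarrow> real"
      using integrable_mult_indicator[of A lborel f] that by (simp_all add: mult.commute)
    \<comment> \<open>Read as the indicator of a preimage, the shifted factor is covered by the
      integrability facts \<open>ind\<close>.\<close>
    have t_ind: "indicator E (x - t) = (indicator ((\<lambda>x. x - t) -` E) x :: real)" for x
      by (simp add: indicator_def)
    have tE: "(\<lambda>x. x - t) -` E \<in> sets borel"
      using measurable_sets[of "\<lambda>x. x - t" borel borel E] by simp
    have "integral\<^sup>L lborel (s n) =
      real (Suc n) * ((\<integral>x. indicator E x * g (x + t) \<partial>lborel) - (\<integral>x. indicator E x * g x \<partial>lborel))"
      by (subst Bochner_Integration.integral_diff[symmetric])
        (auto simp: s_def[abs_def] t_def[symmetric] algebra_simps gi gti ind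
          simp del: of_nat_Suc Bochner_Integration.integral_diff  simp flip: integral_mult_right_zero)
    also have "(\<integral>x. indicator E x * g (x + t) \<partial>lborel) = (\<integral>x. indicator E (x - t) * g x \<partial>lborel)"
      using integral_lborel_shift[of "\<lambda>x. indicator E (x - t) * g x" t] by (simp add: add.commute)
    also have "real (Suc n) * ((\<integral>x. indicator E (x - t) * g x \<partial>lborel) - (\<integral>x. indicator E x * g x \<partial>lborel)) =
      (\<integral>x. real (Suc n) * (indicator E (x - t) - indicator E x) * g x \<partial>lborel)"
      unfolding t_ind
      by (subst Bochner_Integration.integral_diff[symmetric])
        (auto simp: algebra_simps gi ind tE simp del: of_nat_Suc Bochner_Integration.integral_diff simp flip: integral_mult_right_zero)
    finally show ?thesis unfolding t_def .
  qed
  ultimately show ?thesis by simp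
qed

text \<open>Every difference quotient of the indicator vanishes when \<open>E\<close> is invariant
  along \<open>b\<close>, so the preceding limit is that of a zero sequence.\<close>

lemma set_integral_invariant_derivative:
  fixes g :: "'a::euclidean_space \<Rightarrow> real"
  assumes g: "\<And>x. (g has_derivative g' x) (at x)"
    and cont: "continuous_on UNIV (\<lambda>x. g' x b)"
    and K: "compact K" "\<And>x. x \<notin> K \<Longrightarrow> g x = 0"
    and E: "E \<in> sets borel" "\<And>x t. x - t *\<^sub>R b \<in> E \<longleftrightarrow> x \<in> E"
  shows "(\<integral>x. indicator E x * g' x b \<partial>lborel) = 0"
proof -
  have "indicator E (x - t *\<^sub>R b) = (indicator E x :: real)" for x t
    using E(2) by (simp add: indicator_def)
  with set_integral_directional_derivative[OF g cont K E(1)] show ?thesis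
    by (simp add: LIMSEQ_const_iff)
qed

text \<open>The integral equals minus the integral of \<open>g\<close> over the bounding hyperplane;
  only its sign is needed. The difference quotient of the indicator lives on a slab of width
  1/(n+1), where \<open>g\<close> is at most \<open>M\<close> times the width. The factor n+1
  cancels the width, and the volume of the slab inside \<open>K\<close> tends to 0.\<close>

lemma half_space_integral_derivative_nonneg:
  fixes g :: "'a::euclidean_space \<Rightarrow> real"
  assumes g: "\<And>x. (g has_derivative g' x) (at x)"
    and cont: "continuous_on UNIV (\<lambda>x. g' x e)"
    and K: "compact K" "\<And>x. x \<notin> K \<Longrightarrow> g x = 0"
    and e: "norm e = 1"
    and neg: "\<And>x. x \<bullet> e = 0 \<Longrightarrow> g x \<le> 0"
  shows "(\<integral>x. indicator {x. x \<bullet> e > 0} x * g' x e \<partial>lborel) \<ge> 0"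
proof -
  let ?E = "{x. x \<bullet> e > 0}"
  let ?S = "\<lambda>n. {x. 0 < x \<bullet> e \<and> x \<bullet> e \<le> 1 / real (Suc n)}"
  have ee: "e \<bullet> e = 1" using e by (simp add: dot_square_norm)
  have gc: "continuous_on UNIV g"
    using g by (meson has_derivative_continuous continuous_at_imp_continuous_on)
  have [measurable]: "g \<in> borel_measurable borel" "K \<in> sets borel"
    using gc K compact_imp_closed by (auto intro: borel_measurable_continuous_onI borel_closed)
  have g'0: "g' x e = 0" if "x \<notin> K" for x
    using supported_derivative_eq_0[OF g compact_imp_closed[OF K(1)] K(2) that] by simp
  obtain M where M: "M \<ge> 0" "\<And>x. \<bar>g' x e\<bar> \<le> M"
    using bounded_continuous_compact_support[OF cont K(1) g'0] by blast
  have bnd: "g x \<le> M * (x \<bullet> e) * indicator K x" if "0 < x \<bullet> e" for x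
  proof (cases "x \<in> K")
    case True
    have xe: "0 \<le> x \<bullet> e" using that by simp
    \<comment> \<open>Comparison of \<open>x\<close> with its orthogonal projection onto the
      hyperplane, where \<open>g\<close> is nonpositive.\<close>
    obtain s where s: "g (x - (x \<bullet> e) *\<^sub>R e + (x \<bullet> e) *\<^sub>R e) - g (x - (x \<bullet> e) *\<^sub>R e) =
        (x \<bullet> e) * g' (x - (x \<bullet> e) *\<^sub>R e + s *\<^sub>R e) e"
      using mvt_segment[OF g xe] by blast
    have "g (x - (x \<bullet> e) *\<^sub>R e) \<le> 0"
      by (rule neg) (simp add: inner_diff_left ee)
    with s have "g x \<le> (x \<bullet> e) * g' (x - (x \<bullet> e) *\<^sub>R e + s *\<^sub>R e) e" by simp
    also have "\<dots> \<le> (x \<bullet> e) * M"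
      using M(2) that by (intro mult_left_mono) (auto simp: abs_le_iff)
    finally show ?thesis using True by (simp add: mult.commute)
  qed (use K in auto)
  have Ki: "integrable lborel (indicator K :: 'a \<Rightarrow> real)"
    using emeasure_bounded_finite[OF compact_imp_bounded[OF K(1)]] by (intro integrable_real_indicator) auto
  \<comment> \<open>The half-open slabs exclude the hyperplane, so they decrease to the empty set
    and each point leaves them eventually.\<close>
  have lim0: "(\<lambda>n. - (\<integral>x. M * (indicator (?S n) x * indicator K x) \<partial>lborel)) \<longlonglongrightarrow> - (\<integral>x. 0 \<partial>(lborel :: 'a measure))"
  proof (intro tendsto_minus integral_dominated_convergence[where w = "\<lambda>x. M * indicator K x"] AE_I2)
    show "(\<lambda>n. M * (indicator (?S n) x * indicator K x)) \<longlonglongrightarrow> 0" for x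
    proof (cases "x \<bullet> e > 0")
      case True
      then obtain N where N: "1 / real (Suc N) < x \<bullet> e"
        using nat_approx_posE by blast
      have "M * (indicator (?S n) x * indicator K x) = 0" if "n \<ge> N" for n
      proof -
        have "1 / real (Suc n) \<le> 1 / real (Suc N)"
          using that by (intro divide_left_mono) auto
        then show ?thesis using N by auto
      qed
      then show ?thesis
        by (intro tendsto_eventually) (auto simp: eventually_sequentially)
    qed simp
    show "norm (M * (indicator (?S n) x * indicator K x)) \<le> M * indicator K x" for n x
      using M(1) by (auto simp: indicator_def)
  qed (use Ki in auto)
  have gi: "integrable lborel g"
    by (rule integrable_continuous_compact_support[OF gc K])
  have lower: "- (\<integral>x. M * (indicator (?S n) x * indicator K x) \<partial>lborel) \<le>
    (\<integral>x. real (Suc n) * (indicator ?E (x - (1 / real (Suc n)) *\<^sub>R e) - indicator ?E x) * g x \<partial>lborel)" for n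
  proof -
    have eq: "real (Suc n) * (indicator ?E (x - (1 / real (Suc n)) *\<^sub>R e) - indicator ?E x) * g x =
        - (real (Suc n) * (indicator (?S n) x * g x))" for x
      by (auto simp: indicator_def inner_diff_left ee simp del: of_nat_Suc)
        (smt (verit) divide_nonneg_nonneg of_nat_0_le_iff)
    have *: "indicator (?S n) x * g x \<le> (1 / real (Suc n)) * (M * (indicator (?S n) x * indicator K x))" for x
    proof (cases "x \<in> ?S n")
      case True
      then have "g x \<le> M * (x \<bullet> e) * indicator K x" using bnd by auto
      also have "\<dots> \<le> M * (1 / real (Suc n)) * indicator K x"
        using True M(1) by (intro mult_right_mono mult_left_mono) auto
      finally show ?thesis using True by (simp add: mult_ac)
    qed simp
    have "real (Suc n) * (indicator (?S n) x * g x) \<le> M * (indicator (?S n) x * indicator K x)" for x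
      using mult_left_mono[OF *[of x], of "real (Suc n)"] by (simp del: of_nat_Suc)
    then show ?thesis
      unfolding eq Bochner_Integration.integral_minus neg_le_iff_le
      using integrable_mult_indicator[OF _ gi] integrable_mult_indicator[OF _ Ki]
      by (intro integral_mono integrable_mult_right) auto
  qed
  have "?E \<in> sets borel" by simp
  from LIMSEQ_le[OF lim0 set_integral_directional_derivative[OF g cont K this]] lower show ?thesis
    by auto
qed

section \<open>Continuously differentiable maps\<close>

text \<open>Continuity of the derivative is required direction by direction, which matches the form
  used in \<open>test_fields\<close> and in finite dimension amounts to continuity in operator norm.
  Derivatives are taken in the full space, not within \<open>S\<close>.\<close>

definition C1_on :: "'a::real_normed_vector set \<Rightarrow> ('a \<Rightarrow> 'b::real_normed_vector) \<Rightarrow> bool"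
  where "C1_on S f \<longleftrightarrow> (\<exists>f'. (\<forall>x\<in>S. (f has_derivative f' x) (at x)) \<and> (\<forall>h. continuous_on S (\<lambda>x. f' x h)))"

lemma C1_onI:
  assumes "\<And>x. x \<in> S \<Longrightarrow> (f has_derivative f' x) (at x)" and "\<And>h. continuous_on S (\<lambda>x. f' x h)"
  shows "C1_on S f"
  using assms unfolding C1_on_def by blast

lemma C1_onE:
  assumes "C1_on S f"
  obtains f' where "\<And>x. x \<in> S \<Longrightarrow> (f has_derivative f' x) (at x)" and "\<And>h. continuous_on S (\<lambda>x. f' x h)"
  using assms unfolding C1_on_def by blast

lemma C1_on_imp_continuous_on: "C1_on S f \<Longrightarrow> continuous_on S f"
  by (metis C1_onE continuous_at_imp_continuous_on has_derivative_continuous)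

lemma C1_on_linear: "bounded_linear f \<Longrightarrow> C1_on S f"
  by (rule C1_onI[where f' = "\<lambda>_. f"]) (auto intro: bounded_linear_imp_has_derivative)

lemma C1_on_const: "C1_on S (\<lambda>_. c)"
  by (rule C1_onI[where f' = "\<lambda>_ _. 0"]) auto

lemma C1_on_add:
  assumes "C1_on S f" and "C1_on S g"
  shows "C1_on S (\<lambda>x. f x + g x)"
proof -
  obtain f' where f': "\<And>x. x \<in> S \<Longrightarrow> (f has_derivative f' x) (at x)" "\<And>h. continuous_on S (\<lambda>x. f' x h)"
    by (rule C1_onE[OF assms(1)]) (auto)
  obtain g' where g': "\<And>x. x \<in> S \<Longrightarrow> (g has_derivative g' x) (at x)" "\<And>h. continuous_on S (\<lambda>x. g' x h)"
    by (rule C1_onE[OF assms(2)]) (auto)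
  show ?thesis
    by (rule C1_onI[where f' = "\<lambda>x h. f' x h + g' x h"]) (auto intro!: has_derivative_add continuous_on_add f' g')
qed

lemma C1_on_scaleR:
  assumes "C1_on S f" and "C1_on S g"
  shows "C1_on S (\<lambda>x. f x *\<^sub>R g x)"
proof -
  obtain f' where f': "\<And>x. x \<in> S \<Longrightarrow> (f has_derivative f' x) (at x)" "\<And>h. continuous_on S (\<lambda>x. f' x h)"
    by (rule C1_onE[OF assms(1)]) (auto)
  obtain g' where g': "\<And>x. x \<in> S \<Longrightarrow> (g has_derivative g' x) (at x)" "\<And>h. continuous_on S (\<lambda>x. g' x h)"
    by (rule C1_onE[OF assms(2)]) (auto)
  show ?thesis
    by (rule C1_onI[where f' = "\<lambda>x h. f x *\<^sub>R g' x h + f' x h *\<^sub>R g x"])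
      (auto intro!: has_derivative_scaleR continuous_on_add continuous_on_scaleR f' g' assms[THEN C1_on_imp_continuous_on])
qed

lemma C1_on_mult: "C1_on S f \<Longrightarrow> C1_on S g \<Longrightarrow> C1_on S (\<lambda>x. f x * g x)" for f g :: "_ \<Rightarrow> real"
  using C1_on_scaleR[of S f g] by simp

lemma C1_on_uminus: "C1_on S f \<Longrightarrow> C1_on S (\<lambda>x. - f x)"
  using C1_on_scaleR[OF C1_on_const, of S f "-1"] by simp

lemma C1_on_diff: "C1_on S f \<Longrightarrow> C1_on S g \<Longrightarrow> C1_on S (\<lambda>x. f x - g x)"
  using C1_on_add[OF _ C1_on_uminus, of S f g] by simp

lemma C1_on_compose_real:
  assumes "C1_on S f" and "\<And>x. x \<in> S \<Longrightarrow> (g has_real_derivative g' (f x)) (at (f x))" and "continuous_on (f ` S) g'"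
  shows "C1_on S (\<lambda>x. g (f x))"
proof -
  obtain f' where f': "\<And>x. x \<in> S \<Longrightarrow> (f has_derivative f' x) (at x)" "\<And>h. continuous_on S (\<lambda>x. f' x h)"
    by (rule C1_onE[OF assms(1)]) (auto)
  show ?thesis
  proof (rule C1_onI[where f' = "\<lambda>x h. g' (f x) * f' x h"])
    show "((\<lambda>x. g (f x)) has_derivative (\<lambda>h. g' (f x) * f' x h)) (at x)" if "x \<in> S" for x
      using has_derivative_compose[OF f'(1)[OF that]] assms(2)[OF that] unfolding has_field_derivative_def by blast
    show "continuous_on S (\<lambda>x. g' (f x) * f' x h)" for h
      by (intro continuous_intros f' continuous_on_compose2[OF assms(3)] C1_on_imp_continuous_on assms(1)) auto
  qed
qed

lemma C1_on_divide:
  fixes f g :: "_ \<Rightarrow> real"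
  assumes "C1_on S f" and "C1_on S g" and "\<And>x. x \<in> S \<Longrightarrow> g x \<noteq> 0"
  shows "C1_on S (\<lambda>x. f x / g x)"
proof -
  have "C1_on S (\<lambda>x. inverse (g x))"
    using assms
    by (intro C1_on_compose_real[where g = inverse and g' = "\<lambda>y. - (inverse y ^ Suc (Suc 0))"] DERIV_inverse continuous_intros) auto
  from C1_on_mult[OF assms(1) this] show ?thesis by (simp add: divide_inverse)
qed

lemma C1_on_norm: "0 \<notin> S \<Longrightarrow> C1_on S norm" for S :: "'a::real_inner set"
proof (rule C1_onI[where f' = "\<lambda>x h. h \<bullet> sgn x"])
  assume "0 \<notin> S"
  then show "(norm has_derivative (\<lambda>h. h \<bullet> sgn x)) (at x)" if "x \<in> S" for x
    using that by (intro has_derivative_norm) auto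
  show "continuous_on S (\<lambda>x. h \<bullet> sgn x)" for h
    using \<open>0 \<notin> S\<close> unfolding sgn_div_norm by (intro continuous_intros) auto
qed

lemma C1_on_transform:
  assumes "C1_on S f" and "open S" and "\<And>x. x \<in> S \<Longrightarrow> g x = f x"
  shows "C1_on S g"
proof -
  obtain f' where f': "\<And>x. x \<in> S \<Longrightarrow> (f has_derivative f' x) (at x)" "\<And>h. continuous_on S (\<lambda>x. f' x h)"
    by (rule C1_onE[OF assms(1)]) (auto)
  show ?thesis
    by (rule C1_onI[OF has_derivative_transform_within_open[OF f'(1) assms(2)]]) (use assms f' in auto)
qed

text \<open>Uniqueness of derivatives makes the two candidates agree on the overlap, and continuity
  is local on open sets. It serves to glue a field to its extension by zero.\<close>

lemma C1_on_open_Un: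
  assumes "C1_on S f" and "C1_on T f" and "open S" and "open T"
  shows "C1_on (S \<union> T) f"
proof -
  obtain f1 where f1: "\<And>x. x \<in> S \<Longrightarrow> (f has_derivative f1 x) (at x)" "\<And>h. continuous_on S (\<lambda>x. f1 x h)"
    by (rule C1_onE[OF assms(1)]) (auto)
  obtain f2 where f2: "\<And>x. x \<in> T \<Longrightarrow> (f has_derivative f2 x) (at x)" "\<And>h. continuous_on T (\<lambda>x. f2 x h)"
    by (rule C1_onE[OF assms(2)]) (auto)
  define f' where "f' x = (if x \<in> S then f1 x else f2 x)" for x
  have 1: "f' x = f1 x" if "x \<in> S" for x using that by (simp add: f'_def)
  have 2: "f' x = f2 x" if "x \<in> T" for x
    using that has_derivative_unique[OF f1(1) f2(1)] by (simp add: f'_def)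
  show ?thesis
  proof (rule C1_onI[where f' = f'])
    show "(f has_derivative f' x) (at x)" if "x \<in> S \<union> T" for x
      using that 1 2 f1 f2 by auto
    show "continuous_on (S \<union> T) (\<lambda>x. f' x h)" for h
    proof (intro continuous_on_open_Un assms)
      show "continuous_on S (\<lambda>x. f' x h)"
        using f1(2)[of h] by (rule continuous_on_eq) (simp add: 1)
      show "continuous_on T (\<lambda>x. f' x h)"
        using f2(2)[of h] by (rule continuous_on_eq) (simp add: 2)
    qed
  qed
qed

section \<open>Divergence and test fields\<close>

lemma divergence_eq: "(f has_derivative D) (at x) \<Longrightarrow> divergence f x = (\<Sum>b\<in>Basis. D b \<bullet> b)"
  unfolding divergence_def by (metis frechet_derivative_at)

lemma divergence_const [simp]: "divergence (\<lambda>_. c) x = 0"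
  using divergence_eq[of "\<lambda>_. c" "\<lambda>_. 0" x] by simp

lemma divergence_ident [simp]: "divergence (\<lambda>x. x) x = real DIM('a)" for x :: "'a::euclidean_space"
  using divergence_eq[of "\<lambda>x. x" "\<lambda>x. x" x] by simp

lemma divergence_add:
  assumes "f differentiable (at x)" and "g differentiable (at x)"
  shows "divergence (\<lambda>x. f x + g x) x = divergence f x + divergence g x"
proof -
  obtain f' g' where *: "(f has_derivative f') (at x)" "(g has_derivative g') (at x)"
    using assms unfolding differentiable_def by blast
  show ?thesis
    unfolding divergence_eq[OF *(1)] divergence_eq[OF *(2)] divergence_eq[OF has_derivative_add[OF *]]
    by (simp add: inner_add_left sum.distrib)
qed

text \<open>Expanding \<open>Y x\<close> in the basis turns the gradient term into the derivative of
  \<open>f\<close> along \<open>Y\<close>, so gradients never have to be formed.\<close>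

lemma divergence_scaleR:
  fixes f :: "'a::euclidean_space \<Rightarrow> real"
  assumes "(f has_derivative f') (at x)" and "Y differentiable (at x)"
  shows "divergence (\<lambda>x. f x *\<^sub>R Y x) x = f x * divergence Y x + f' (Y x)"
proof -
  obtain Y' where Y': "(Y has_derivative Y') (at x)"
    using assms unfolding differentiable_def by blast
  have "f' (Y x) = f' (\<Sum>b\<in>Basis. (Y x \<bullet> b) *\<^sub>R b)"
    by (simp add: euclidean_representation)
  also have "\<dots> = (\<Sum>b\<in>Basis. (Y x \<bullet> b) * f' b)"
    using has_derivative_linear[OF assms(1)] by (simp add: linear_sum linear_scale)
  finally show ?thesis
    unfolding divergence_eq[OF Y'] divergence_eq[OF has_derivative_scaleR[OF assms(1) Y']]
    by (simp add: inner_add_left sum.distrib sum_distrib_left mult.commute)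
qed

lemma divergence_transform:
  assumes "f differentiable (at x)" and "open S" and "x \<in> S" and "\<And>y. y \<in> S \<Longrightarrow> f y = g y"
  shows "divergence g x = divergence f x"
proof -
  obtain f' where *: "(f has_derivative f') (at x)"
    using assms unfolding differentiable_def by blast
  show ?thesis
    using divergence_eq[OF *] divergence_eq[OF has_derivative_transform_within_open[OF * assms(2,3,4)]] by simp
qed

lemma C1_on_divergence_continuous:
  assumes "C1_on UNIV f"
  shows "continuous_on UNIV (divergence f)"
proof -
  obtain f' where f': "\<And>x. (f has_derivative f' x) (at x)" "\<And>h. continuous_on UNIV (\<lambda>x. f' x h)"
    by (rule C1_onE[OF assms]) (auto)
  have "divergence f = (\<lambda>x. \<Sum>b\<in>Basis. f' x b \<bullet> b)"
    using divergence_eq[OF f'(1)] by auto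
  then show ?thesis
    by (auto intro!: continuous_intros f')
qed

lemma divergence_eq_0_outside:
  assumes "C1_on UNIV f" and "closed K" and "\<And>y. y \<notin> K \<Longrightarrow> f y = 0" and "x \<notin> K"
  shows "divergence f x = 0"
proof -
  obtain f' where f': "(f has_derivative f') (at x)"
    by (rule C1_onE[OF assms(1)]) (auto)
  show ?thesis
    using divergence_eq[OF f'] supported_derivative_eq_0[OF f' assms(2-4)] by simp
qed

text \<open>One-sided divergence theorem, with outer normal \<open>- e\<close>. Derivatives along
  the other basis vectors integrate to 0 because the half-space is invariant in those directions,
  and the derivative along \<open>e\<close> is controlled by the sign of the normal component on the
  hyperplane.\<close>

lemma half_space_integral_divergence_nonneg:
  fixes G :: "'a::euclidean_space \<Rightarrow> 'a"
  assumes G: "C1_on UNIV G" and K: "compact K" "\<And>x. x \<notin> K \<Longrightarrow> G x = 0"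
    and e: "e \<in> Basis" and neg: "\<And>x. x \<bullet> e = 0 \<Longrightarrow> G x \<bullet> e \<le> 0"
  shows "(\<integral>x. indicator {x. x \<bullet> e > 0} x * divergence G x \<partial>lborel) \<ge> 0"
proof -
  let ?E = "{x. x \<bullet> e > 0}"
  obtain G' where G': "\<And>x. (G has_derivative G' x) (at x)" "\<And>h. continuous_on UNIV (\<lambda>x. G' x h)"
    by (rule C1_onE[OF G]) (auto)
  have d: "((\<lambda>x. G x \<bullet> b) has_derivative (\<lambda>h. G' x h \<bullet> b)) (at x)" for x b
    by (intro has_derivative_inner_left G')
  have c: "continuous_on UNIV (\<lambda>x. G' x h \<bullet> b)" for h b
    by (intro continuous_intros G')
  have k: "G x \<bullet> b = 0" if "x \<notin> K" for x b
    using K(2)[OF that] by simp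
  have 0: "(\<integral>x. indicator ?E x * (G' x b \<bullet> b) \<partial>lborel) = 0" if "b \<in> Basis" "b \<noteq> e" for b
    using that e by (intro set_integral_invariant_derivative[OF d c K(1) k]) (auto simp: inner_diff_left inner_Basis)
  have pos: "(\<integral>x. indicator ?E x * (G' x e \<bullet> e) \<partial>lborel) \<ge> 0"
    using e neg by (intro half_space_integral_derivative_nonneg[OF d c K(1) k]) auto
  have int: "integrable lborel (\<lambda>x. indicator ?E x * (G' x b \<bullet> b))" for b
  proof -
    have "integrable lborel (\<lambda>x. G' x b \<bullet> b)"
      using supported_derivative_eq_0[OF d compact_imp_closed[OF K(1)] k]
      by (intro integrable_continuous_compact_support[OF c K(1)]) meson
    from integrable_mult_indicator[OF _ this, of ?E] show ?thesis by simp
  qed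
  have "(\<integral>x. indicator ?E x * divergence G x \<partial>lborel) = (\<Sum>b\<in>Basis. \<integral>x. indicator ?E x * (G' x b \<bullet> b) \<partial>lborel)"
    unfolding divergence_eq[OF G'(1)] sum_distrib_left by (intro Bochner_Integration.integral_sum int)
  also have "\<dots> = (\<integral>x. indicator ?E x * (G' x e \<bullet> e) \<partial>lborel)"
    using 0 by (subst sum.remove[OF finite_Basis e]) auto
  finally show ?thesis using pos by simp
qed

text \<open>Continuity of the derivative is given on basis vectors only; linearity carries it to
  every direction.\<close>

lemma test_fields_C1_on: "\<phi> \<in> test_fields V \<Longrightarrow> C1_on UNIV \<phi>"
proof (rule C1_onI[where f' = "\<lambda>x. frechet_derivative \<phi> (at x)"])
  assume \<phi>: "\<phi> \<in> test_fields V"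
  then show *: "(\<phi> has_derivative frechet_derivative \<phi> (at x)) (at x)" for x
    by (simp add: test_fields_def frechet_derivative_works[symmetric])
  fix h :: 'a
  have "frechet_derivative \<phi> (at x) h = (\<Sum>b\<in>Basis. (h \<bullet> b) *\<^sub>R frechet_derivative \<phi> (at x) b)" for x
  proof -
    interpret linear "frechet_derivative \<phi> (at x)"
      using * by (rule has_derivative_linear)
    show ?thesis
      by (subst euclidean_representation[of h, symmetric]) (simp add: sum scale)
  qed
  then show "continuous_on UNIV (\<lambda>x. frechet_derivative \<phi> (at x) h)"
    using \<phi> by (auto simp: test_fields_def intro!: continuous_intros)
qed

lemma test_fieldsI:
  assumes "C1_on UNIV \<phi>" and "compact K" and "K \<subseteq> V" and "\<And>x. x \<notin> K \<Longrightarrow> \<phi> x = 0" and "\<And>x. norm (\<phi> x) \<le> 1"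
  shows "\<phi> \<in> test_fields V"
proof -
  obtain f' where f': "\<And>x. (\<phi> has_derivative f' x) (at x)" "\<And>h. continuous_on UNIV (\<lambda>x. f' x h)"
    by (rule C1_onE[OF assms(1)]) (auto)
  have "frechet_derivative \<phi> (at x) = f' x" for x
    using f'(1) by (metis frechet_derivative_at)
  moreover have cl: "closure {x. \<phi> x \<noteq> 0} \<subseteq> K"
    using assms by (intro closure_minimal) (auto intro: compact_imp_closed)
  moreover have "compact (closure {x. \<phi> x \<noteq> 0})"
    using bounded_subset[OF compact_imp_bounded[OF assms(2)] cl] by (simp add: compact_eq_bounded_closed)
  moreover have "\<forall>x. \<phi> differentiable (at x)"
    using f'(1) unfolding differentiable_def by blast
  ultimately show ?thesis
    using f' assms unfolding test_fields_def compactly_contained_def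
    by auto
qed

section \<open>The calibration\<close>

text \<open>Here \<open>e\<close> is the direction of the first coordinate and \<open>k\<close> that
  of the axis of the cone. The ambient dimension is n + 1, so \<open>dim\<close> encodes \<alpha> =
  (n - 3) / 2, and \<open>c_le\<close> is the form taken by the upper bound on the opening
  parameter.\<close>

locale cone_calibration =
  fixes e k :: "'a::euclidean_space" and c \<alpha> :: real
  assumes e: "e \<in> Basis" and k: "k \<in> Basis" and e_neq_k: "e \<noteq> k"
    and \<alpha>_pos: "0 < \<alpha>" and dim: "real DIM('a) = 2 * \<alpha> + 4"
    and c_pos: "0 < c" and c_le: "c * (1 + \<alpha>) \<le> \<alpha>"
begin

text \<open>The full norm is used because it is smooth away from the vertex, whereas the norm of the
  horizontal part is singular along the axis, which lies inside the cone.\<close>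

definition height :: "'a \<Rightarrow> real"
  where "height p = p \<bullet> k - c * norm p"

definition Q :: "'a \<Rightarrow> real"
  where "Q p = norm p * (norm p + p \<bullet> k)"

text \<open>With w = \<open>norm p + p \<bullet> k\<close>, the gradient of w is
  \<open>norm p *\<^sub>R k + p\<close> divided by \<open>norm p\<close>. Division by
  \<open>Q p\<close> therefore produces the gradient of log w.\<close>

definition direction :: "'a \<Rightarrow> 'a"
  where "direction p = e + (\<alpha> * (p \<bullet> e) / Q p) *\<^sub>R (norm p *\<^sub>R k + p)"

definition damping :: "'a \<Rightarrow> real"
  where "damping p = exp (- (\<alpha> * (1 + \<alpha>)) * ((p \<bullet> e)\<^sup>2 / Q p))"

definition calibration :: "'a \<Rightarrow> 'a"
  where "calibration p = damping p *\<^sub>R direction p"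

lemma inner_basis [simp]: "e \<bullet> e = 1" "k \<bullet> k = 1" "e \<bullet> k = 0" "k \<bullet> e = 0"
  using e k e_neq_k by (auto simp: inner_Basis)

lemma inside:
  assumes "height p > 0"
  shows "norm p > 0" and "p \<bullet> k > 0" and "Q p > 0" and "p \<noteq> 0"
proof -
  show "p \<noteq> 0" using assms by (auto simp: height_def)
  then show n: "norm p > 0" by simp
  have "c * norm p > 0" using n c_pos by simp
  with assms show t: "p \<bullet> k > 0" by (simp add: height_def)
  show "Q p > 0" unfolding Q_def using n t by (intro mult_pos_pos add_pos_pos)
qed

lemma Q_nonzero: "height p > 0 \<Longrightarrow> Q p \<noteq> 0"
  using inside(3)[of p] by simp

text \<open>For W = \<open>norm p *\<^sub>R k + p\<close> one has W . W = 2 \<open>Q p\<close>, W .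
  p = \<open>Q p\<close>, W . e = \<open>p \<bullet> e\<close> and W . k =
  \<open>norm p + p \<bullet> k\<close>; the four formulas follow by expansion.\<close>

lemma inner_direction:
  assumes "height p > 0"
  shows "direction p \<bullet> e = 1 + \<alpha> * ((p \<bullet> e)\<^sup>2 / Q p)"
    and "direction p \<bullet> k = \<alpha> * (p \<bullet> e) / norm p"
    and "p \<bullet> direction p = (1 + \<alpha>) * (p \<bullet> e)"
    and "direction p \<bullet> direction p = 1 + 2 * (\<alpha> * (1 + \<alpha>)) * ((p \<bullet> e)\<^sup>2 / Q p)"
proof -
  note pos = inside[OF assms]
  define x t r where "x = p \<bullet> e" and "t = p \<bullet> k" and "r = norm p"
  have rt: "r > 0" "t > 0" using pos by (simp_all add: r_def t_def)
  then have rt: "r > 0" "t > 0" "r + t > 0" "r + t \<noteq> 0" by simp_all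
  have pp: "p \<bullet> p = r * r" by (simp add: r_def power2_eq_square flip: power2_norm_eq_inner)
  have ip: "e \<bullet> p = x" "k \<bullet> p = t" by (simp_all add: x_def t_def inner_commute)
  note inn = inner_add_left inner_add_right inner_scaleR_left inner_scaleR_right
  show "direction p \<bullet> e = 1 + \<alpha> * ((p \<bullet> e)\<^sup>2 / Q p)"
    by (simp add: direction_def inn power2_eq_square)
  show "direction p \<bullet> k = \<alpha> * (p \<bullet> e) / norm p"
    unfolding direction_def Q_def inn inner_basis x_def[symmetric] t_def[symmetric] r_def[symmetric]
    using rt by (simp add: divide_simps) (simp add: algebra_simps)?
  show "p \<bullet> direction p = (1 + \<alpha>) * (p \<bullet> e)"
    unfolding direction_def Q_def inn inner_basis pp x_def[symmetric] t_def[symmetric] r_def[symmetric]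
    using rt by (simp add: divide_simps) (simp add: algebra_simps)
  show "direction p \<bullet> direction p = 1 + 2 * (\<alpha> * (1 + \<alpha>)) * ((p \<bullet> e)\<^sup>2 / Q p)"
    unfolding direction_def Q_def inn inner_basis pp ip x_def[symmetric] t_def[symmetric] r_def[symmetric]
    using rt by (simp add: divide_simps) (simp add: power2_eq_square algebra_simps)
qed

text \<open>The squared norm is exp (-2y) (1 + 2y), and 1 + z is at most exp z. The constant in
  \<open>damping\<close> is chosen to match the excess of the squared norm of
  \<open>direction\<close> over 1.\<close>

lemma norm_calibration_le_1:
  assumes "height p > 0"
  shows "norm (calibration p) \<le> 1"
proof -
  define y where "y = \<alpha> * (1 + \<alpha>) * ((p \<bullet> e)\<^sup>2 / Q p)"
  have "(norm (calibration p))\<^sup>2 = (exp (- y))\<^sup>2 * (1 + 2 * y)"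
  proof -
    have "damping p = exp (- y)" and "(norm (direction p))\<^sup>2 = 1 + 2 * y"
      using inner_direction(4)[OF assms] by (simp_all add: damping_def y_def power2_norm_eq_inner)
    then show ?thesis by (simp add: calibration_def power_mult_distrib)
  qed
  also have "\<dots> \<le> (exp (- y))\<^sup>2 * exp (2 * y)"
    by (intro mult_left_mono exp_ge_add_one_self) auto
  also have "\<dots> = 1"
    by (simp flip: exp_double exp_add)
  finally show ?thesis
    by (simp add: power2_le_iff_abs_le abs_square_le_1)
qed

lemma calibration_on_hyperplane: "p \<bullet> e = 0 \<Longrightarrow> calibration p = e"
  by (simp add: calibration_def damping_def direction_def)

lemma height_has_derivative:
  assumes "p \<noteq> 0"
  shows "(height has_derivative (\<lambda>v. v \<bullet> k - c * (p \<bullet> v / norm p))) (at p)"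
proof -
  have "(norm has_derivative (\<lambda>v. p \<bullet> v / norm p)) (at p)"
    using has_derivative_norm[OF assms] by (simp add: sgn_div_norm inner_commute divide_inverse mult.commute)
  then show ?thesis
    unfolding height_def[abs_def] by (auto intro!: derivative_eq_intros)
qed

text \<open>The left side is the derivative of \<open>height\<close> along the calibration. Its sign
  relative to \<open>p \<bullet> e\<close> is that of \<alpha> - c (1 + \<alpha>), which is where
  the opening of the cone enters.\<close>

lemma height_derivative_calibration:
  assumes "height p > 0"
  shows "calibration p \<bullet> k - c * (p \<bullet> calibration p / norm p) = damping p * (\<alpha> - c * (1 + \<alpha>)) / norm p * (p \<bullet> e)"
  using inner_direction(2,3)[OF assms] inside[OF assms]
  by (simp add: calibration_def field_simps)

text \<open>By the product rule, the damping factor contributes a term linear in x =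
  \<open>p \<bullet> e\<close> that cancels the divergence of \<open>direction\<close> exactly. What
  remains is cubic in x with a nonnegative coefficient in the cone.\<close>

lemma divergence_calibration:
  assumes "height p > 0"
  shows "divergence calibration p = damping p * (\<alpha> * (1 + \<alpha>)) / Q p * ((p \<bullet> e)\<^sup>2 / Q p)
      * (2 + \<alpha> + (1 + \<alpha>) * (p \<bullet> k / norm p)) * (p \<bullet> e)"
proof -
  note pos = inside[OF assms]
  define x t r where "x = p \<bullet> e" and "t = p \<bullet> k" and "r = norm p"
  have rt: "r > 0" "t > 0" using pos by (simp_all add: r_def t_def)
  then have rt: "r > 0" "t > 0" "r + t > 0" "r + t \<noteq> 0" by simp_all
  have pp: "p \<bullet> p = r * r" by (simp add: r_def power2_eq_square flip: power2_norm_eq_inner)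
  have ip: "e \<bullet> p = x" "k \<bullet> p = t" by (simp_all add: x_def t_def inner_commute)
  have Qp: "Q p = r * (r + t)" by (simp add: Q_def r_def t_def)
  \<comment> \<open>This is \<open>norm q\<close> times the gradient of w; splitting off the scalar
    factor reduces the divergence of \<open>direction\<close> to that of \<open>W\<close>.\<close>
  define W where "W q = norm q *\<^sub>R k + q" for q :: 'a
  define dQ where "dQ v = (p \<bullet> v / r) * (r + t) + r * (p \<bullet> v / r + v \<bullet> k)" for v
  have dn: "(norm has_derivative (\<lambda>v. p \<bullet> v / r)) (at p)"
    using has_derivative_norm[OF pos(4)] by (simp add: r_def sgn_div_norm inner_commute divide_inverse mult.commute)
  have dQ: "(Q has_derivative dQ) (at p)"
    unfolding Q_def[abs_def] dQ_def[abs_def]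
    by (rule derivative_eq_intros refl dn)+ (use pos in \<open>simp add: r_def t_def fun_eq_iff algebra_simps\<close>)
  have Q0: "Q p \<noteq> 0" using pos by simp
  have dq: "((\<lambda>q. \<alpha> * (q \<bullet> e) / Q q) has_derivative (\<lambda>v. \<alpha> * (v \<bullet> e) / Q p - \<alpha> * x * dQ v / (Q p)\<^sup>2)) (at p)"
    by (rule derivative_eq_intros refl dQ Q0)+
       (simp add: x_def fun_eq_iff power2_eq_square divide_simps Q0)
  have dy: "((\<lambda>q. - (\<alpha> * (1 + \<alpha>)) * ((q \<bullet> e)\<^sup>2 / Q q)) has_derivative
      (\<lambda>v. - (\<alpha> * (1 + \<alpha>)) * (2 * x * (v \<bullet> e) / Q p - x\<^sup>2 * dQ v / (Q p)\<^sup>2))) (at p)"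
    by (rule derivative_eq_intros refl dQ Q0)+
       (simp add: x_def fun_eq_iff power2_eq_square divide_simps Q0)
  have ddamp: "(damping has_derivative
      (\<lambda>v. damping p * (- (\<alpha> * (1 + \<alpha>)) * (2 * x * (v \<bullet> e) / Q p - x\<^sup>2 * dQ v / (Q p)\<^sup>2)))) (at p)"
    unfolding damping_def[abs_def] by (rule derivative_eq_intros refl dy)+ (simp add: mult.commute)
  have dk: "((\<lambda>q. norm q *\<^sub>R k) has_derivative (\<lambda>v. (p \<bullet> v / r) *\<^sub>R k)) (at p)"
    by (rule derivative_eq_intros refl dn)+
  have Wd: "W differentiable (at p)"
    unfolding W_def[abs_def] by (intro differentiable_add differentiableI[OF dk]) simp
  have divW: "divergence W p = t / r + (2 * \<alpha> + 4)"
    unfolding W_def[abs_def]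
    by (subst divergence_add) (use divergence_scaleR[OF dn, of "\<lambda>_. k"] dim in
        \<open>auto intro: differentiableI[OF dk] simp: t_def\<close>)
  have We: "W p \<bullet> e = x" "W p \<bullet> k = r + t" "p \<bullet> W p = r * (r + t)"
    by (simp_all add: W_def inner_add_left inner_add_right pp x_def t_def r_def[symmetric] algebra_simps)
  have dQW: "dQ (W p) = (r + t) * (3 * r + t)"
    unfolding dQ_def We using rt by simp (simp add: algebra_simps)
  have dqW: "(\<lambda>q. (\<alpha> * (q \<bullet> e) / Q q) *\<^sub>R W q) differentiable (at p)"
    by (intro derivative_intros differentiableI[OF dq] Wd)
  have dird: "direction differentiable (at p)"
    unfolding direction_def[abs_def] W_def[symmetric] by (intro differentiable_add dqW) simp
  have "divergence direction p = \<alpha> * x / Q p * (t / r + (2 * \<alpha> + 4)) + (\<alpha> * x / Q p - \<alpha> * x * ((r + t) * (3 * r + t)) / (Q p)\<^sup>2)"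
    unfolding direction_def[abs_def] W_def[symmetric]
    by (subst divergence_add) (simp_all add: dqW divergence_scaleR[OF dq Wd] divW We dQW x_def)
  \<comment> \<open>The terms in t / r cancel, and the dimension 2 \<alpha> + 4 leaves the factor 2
    \<alpha> + 4 + 1 - 3 = 2 (1 + \<alpha>).\<close>
  also have "\<dots> = 2 * (\<alpha> * (1 + \<alpha>)) * x / Q p"
    unfolding Qp using rt by (simp add: power2_eq_square divide_simps) (simp add: algebra_simps)
  finally have divV: "divergence direction p = 2 * (\<alpha> * (1 + \<alpha>)) * x / Q p" .
  note V = inner_direction[OF assms, folded x_def t_def r_def]
  have dQV: "dQ (direction p) = x * ((1 + \<alpha>) * (2 + t / r) + \<alpha>)"
    unfolding dQ_def V using rt by (simp add: field_simps)
  have "divergence calibration p = damping p * (2 * (\<alpha> * (1 + \<alpha>)) * x / Q p) +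
      damping p * (- (\<alpha> * (1 + \<alpha>)) * (2 * x * (1 + \<alpha> * (x\<^sup>2 / Q p)) / Q p
        - x\<^sup>2 * (x * ((1 + \<alpha>) * (2 + t / r) + \<alpha>)) / (Q p)\<^sup>2))"
    unfolding calibration_def[abs_def] divergence_scaleR[OF ddamp dird] divV V dQV ..
  also have "\<dots> = damping p * (\<alpha> * (1 + \<alpha>)) / Q p * (x\<^sup>2 / Q p) * (2 + \<alpha> + (1 + \<alpha>) * (t / r)) * x"
    using rt Q0 by (simp add: power2_eq_square divide_simps) (simp add: algebra_simps)
  finally show ?thesis unfolding x_def t_def r_def .
qed

lemma C1_on_Q: "C1_on {p. height p > 0} Q"
  unfolding Q_def[abs_def]
  by (intro C1_on_mult C1_on_add C1_on_norm C1_on_linear bounded_linear_inner_left) (use inside in auto)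

lemma C1_on_calibration: "C1_on {p. height p > 0} calibration"
  unfolding calibration_def[abs_def] damping_def direction_def
  by (intro C1_on_scaleR C1_on_add C1_on_const C1_on_norm C1_on_divide C1_on_mult C1_on_Q
      C1_on_compose_real[where g = exp and g' = exp] C1_on_linear[OF bounded_linear_inner_left]
      C1_on_linear[OF bounded_linear_ident] DERIV_exp continuous_intros)
    (use inside Q_nonzero in \<open>auto simp: power2_eq_square intro!: C1_on_divide C1_on_mult C1_on_Q C1_on_linear[OF bounded_linear_inner_left]\<close>)

lemma continuous_on_height: "continuous_on S height"
  unfolding height_def[abs_def] by (intro continuous_intros)

end

section \<open>Cutoffs\<close>

text \<open>A nondecreasing C1 transition from 0 on s \<le> 0 to 1 on s \<ge> 1, built only from
  squares of positive parts so that one derivative formula holds on the whole line.\<close>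

definition smoothstep :: "real \<Rightarrow> real"
  where "smoothstep s = 1 - (max 0 (1 - (max 0 s)\<^sup>2))\<^sup>2"

text \<open>Squaring removes the kink of the positive part: at 0 the difference quotient is bounded
  by the modulus of the increment.\<close>

lemma max_0_square_has_real_derivative: "((\<lambda>s. (max 0 s)\<^sup>2) has_real_derivative 2 * max 0 s) (at s)"
proof -
  consider "s < 0" | "s = 0" | "s > 0" by linarith
  then show ?thesis
  proof cases
    case 1
    have "((\<lambda>_. 0) has_real_derivative 0) (at s)" by simp
    then have "((\<lambda>s. (max 0 s)\<^sup>2) has_real_derivative 0) (at s)"
      by (rule has_field_derivative_transform_within[where d = "-s"]) (use 1 in \<open>auto simp: dist_real_def max_def\<close>)
    then show ?thesis using 1 by simp
  next
    case 2
    have "((\<lambda>h. (max 0 h)\<^sup>2 / h) \<longlongrightarrow> 0) (at (0::real))"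
    proof (rule Lim_null_comparison)
      show "\<forall>\<^sub>F h in at (0::real). norm ((max 0 h)\<^sup>2 / h) \<le> \<bar>h\<bar>"
        by (auto simp: max_def power2_eq_square)
      show "((\<lambda>h. \<bar>h\<bar>) \<longlongrightarrow> 0) (at (0::real))"
        using tendsto_rabs[OF tendsto_ident_at, of 0 UNIV] by simp
    qed
    then show ?thesis using 2 by (simp add: DERIV_def)
  next
    case 3
    have "((\<lambda>s. s\<^sup>2) has_real_derivative 2 * s) (at s)"
      by (auto intro!: derivative_eq_intros)
    then have "((\<lambda>s. (max 0 s)\<^sup>2) has_real_derivative 2 * s) (at s)"
      by (rule has_field_derivative_transform_within[where d = "s"]) (use 3 in \<open>auto simp: dist_real_def max_def\<close>)
    then show ?thesis using 3 by simp
  qed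
qed

lemma smoothstep_has_real_derivative:
  "(smoothstep has_real_derivative 4 * max 0 (1 - (max 0 s)\<^sup>2) * max 0 s) (at s)"
proof -
  have "((\<lambda>s. 1 - (max 0 s)\<^sup>2) has_real_derivative - (2 * max 0 s)) (at s)"
    using DERIV_diff[OF DERIV_const max_0_square_has_real_derivative] by simp
  from DERIV_diff[OF DERIV_const DERIV_chain2[OF max_0_square_has_real_derivative this], of 1] show ?thesis
    unfolding smoothstep_def[abs_def] by (simp add: mult.assoc)
qed

lemma smoothstep_derivative_nonneg: "4 * max 0 (1 - (max 0 s)\<^sup>2) * max 0 s \<ge> (0::real)"
  by simp

lemma smoothstep_bounds: "0 \<le> smoothstep s" "smoothstep s \<le> 1"
  by (auto simp: smoothstep_def max_def abs_square_le_1)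

lemma smoothstep_eq_0: "s \<le> 0 \<Longrightarrow> smoothstep s = 0"
  by (simp add: smoothstep_def)

lemma smoothstep_eq_1: "s \<ge> 1 \<Longrightarrow> smoothstep s = 1"
  using one_le_power[of s 2] by (simp add: smoothstep_def max_absorb1 max_absorb2)

lemma C1_on_smoothstep: "C1_on S f \<Longrightarrow> C1_on S (\<lambda>x. smoothstep (f x))"
  by (rule C1_on_compose_real[where g' = "\<lambda>s. 4 * max 0 (1 - (max 0 s)\<^sup>2) * max 0 s", OF _ smoothstep_has_real_derivative])
    (auto intro!: continuous_intros)

text \<open>The norm attains its maximum on \<open>K\<close>, and the midpoint between that maximum
  and \<open>R\<close> works. The gap left below \<open>R\<close> makes room for a radial
  cutoff.\<close>

lemma compact_subset_ball_shrink:
  fixes K :: "'a::real_normed_vector set"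
  assumes "compact K" and "K \<subseteq> ball 0 R" and "R > 0"
  obtains r where "0 < r" and "r < R" and "K \<subseteq> ball 0 r"
proof (cases "K = {}")
  case True
  with that[of "R / 2"] assms show thesis by auto
next
  case False
  obtain x where x: "x \<in> K" "\<And>y. y \<in> K \<Longrightarrow> norm y \<le> norm x"
    using continuous_attains_sup[OF assms(1) False continuous_on_norm_id] by blast
  define r where "r = (norm x + R) / 2"
  have "norm x < R" using x assms by auto
  moreover have "norm x \<ge> 0" by simp
  ultimately have "0 < r" "r < R" "norm x < r" using assms(3) add_nonneg_pos[of "norm x" R] unfolding r_def by auto
  moreover from this(3) x(2) have "K \<subseteq> ball 0 r" by force
  ultimately show thesis using that by blast
qed

lemma compact_pos_lower_bound:
  fixes f :: "'a::topological_space \<Rightarrow> real"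
  assumes "compact K" and "continuous_on K f" and "\<And>x. x \<in> K \<Longrightarrow> f x > 0"
  obtains \<delta> where "\<delta> > 0" and "\<And>x. x \<in> K \<Longrightarrow> f x \<ge> \<delta>"
proof (cases "K = {}")
  case True
  with that[of 1] show thesis by auto
next
  case False
  from continuous_attains_inf[OF assms(1) False assms(2)] assms(3) that show thesis by metis
qed

section \<open>The truncated calibration as a test field\<close>

context cone_calibration
begin

text \<open>The transition takes place between heights \<epsilon> and 2 \<epsilon>. The shift by 1
  makes the cutoff vanish on an open neighbourhood of the complement of the cone, including the
  vertex.\<close>

definition cutoff :: "real \<Rightarrow> 'a \<Rightarrow> real"
  where "cutoff \<epsilon> p = smoothstep (height p / \<epsilon> - 1)"

text \<open>The transition runs from radius \<open>r\<close> to radius \<open>s\<close>; using the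
  squared norm keeps the cutoff C1 at the origin as well.\<close>

definition radial_cutoff :: "real \<Rightarrow> real \<Rightarrow> 'a \<Rightarrow> real"
  where "radial_cutoff r s p = smoothstep ((s\<^sup>2 - p \<bullet> p) / (s\<^sup>2 - r\<^sup>2))"

text \<open>The minus sign aligns the field with the outer normal \<open>- e\<close> of the
  half-space, so that its divergence integral there is as large as the cutoffs allow.\<close>

definition test_field :: "real \<Rightarrow> real \<Rightarrow> real \<Rightarrow> 'a \<Rightarrow> 'a"
  where "test_field \<epsilon> r s p = - ((cutoff \<epsilon> p * radial_cutoff r s p) *\<^sub>R calibration p)"

lemma cutoff_eq_0: "\<epsilon> > 0 \<Longrightarrow> height p \<le> \<epsilon> \<Longrightarrow> cutoff \<epsilon> p = 0"
  unfolding cutoff_def by (rule smoothstep_eq_0) (simp add: field_simps)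

lemma cutoff_eq_1: "\<epsilon> > 0 \<Longrightarrow> height p \<ge> 2 * \<epsilon> \<Longrightarrow> cutoff \<epsilon> p = 1"
  unfolding cutoff_def by (rule smoothstep_eq_1) (simp add: field_simps)

lemma radial_cutoff_eq_1:
  assumes "0 < r" "r < s" "norm p \<le> r"
  shows "radial_cutoff r s p = 1"
proof -
  have "r\<^sup>2 < s\<^sup>2" using assms by (intro power_strict_mono) auto
  moreover have "p \<bullet> p \<le> r\<^sup>2" using assms by (simp add: power_mono flip: power2_norm_eq_inner)
  ultimately show ?thesis unfolding radial_cutoff_def by (intro smoothstep_eq_1) simp
qed

lemma radial_cutoff_eq_0:
  assumes "0 < r" "r < s" "s \<le> norm p"
  shows "radial_cutoff r s p = 0"
proof -
  have "r\<^sup>2 < s\<^sup>2" using assms by (intro power_strict_mono) auto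
  moreover have "s\<^sup>2 \<le> p \<bullet> p" using assms by (simp add: power_mono flip: power2_norm_eq_inner)
  ultimately show ?thesis unfolding radial_cutoff_def by (intro smoothstep_eq_0 divide_nonpos_pos) simp_all
qed

lemma C1_on_cutoff: "C1_on {p. height p > 0} (cutoff \<epsilon>)"
proof -
  have "C1_on {p. height p > 0} height"
    unfolding height_def[abs_def]
    by (intro C1_on_diff C1_on_mult C1_on_const C1_on_norm C1_on_linear[OF bounded_linear_inner_left]) auto
  then have "C1_on {p. height p > 0} (\<lambda>p. height p * (1 / \<epsilon>) - 1)"
    by (intro C1_on_diff C1_on_mult C1_on_const)
  from C1_on_smoothstep[OF this] show ?thesis
    unfolding cutoff_def[abs_def] by simp
qed

lemma C1_on_radial_cutoff: "C1_on S (radial_cutoff r s)"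
proof -
  have "C1_on S (\<lambda>p. p \<bullet> p)"
    by (rule C1_onI[where f' = "\<lambda>x h. x \<bullet> h + h \<bullet> x"]) (auto intro!: derivative_eq_intros continuous_intros)
  then have "C1_on S (\<lambda>p. (s\<^sup>2 - p \<bullet> p) * (1 / (s\<^sup>2 - r\<^sup>2)))"
    by (intro C1_on_diff C1_on_mult C1_on_const)
  from C1_on_smoothstep[OF this] show ?thesis
    unfolding radial_cutoff_def[abs_def] by simp
qed

lemma test_field_eq_0:
  assumes "\<epsilon> > 0" and "0 < r" "r < s" and "p \<notin> {p. \<epsilon> \<le> height p} \<inter> cball 0 s"
  shows "test_field \<epsilon> r s p = 0"
  using assms cutoff_eq_0[of \<epsilon> p] radial_cutoff_eq_0[of r s p] by (auto simp: test_field_def)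

text \<open>The formula is C1 where \<open>height\<close> is positive, the field is zero where
  \<open>height\<close> is below \<epsilon>, and these two open sets cover the space.\<close>

lemma C1_on_test_field:
  assumes "\<epsilon> > 0"
  shows "C1_on UNIV (test_field \<epsilon> r s)"
proof -
  have "C1_on {p. height p > 0} (test_field \<epsilon> r s)"
    unfolding test_field_def[abs_def]
    by (intro C1_on_uminus C1_on_scaleR C1_on_mult C1_on_cutoff C1_on_radial_cutoff C1_on_calibration)
  moreover have op: "open {p. height p > 0}" "open {p. height p < \<epsilon>}"
    by (intro open_Collect_less continuous_on_const continuous_on_height)+
  moreover have "C1_on {p. height p < \<epsilon>} (test_field \<epsilon> r s)"
    by (rule C1_on_transform[OF C1_on_const[of _ 0] op(2)]) (use assms cutoff_eq_0 in \<open>simp add: test_field_def\<close>)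
  ultimately have "C1_on ({p. height p > 0} \<union> {p. height p < \<epsilon>}) (test_field \<epsilon> r s)"
    by (intro C1_on_open_Un)
  also have "{p. height p > 0} \<union> {p. height p < \<epsilon>} = UNIV"
    using assms by (auto simp: set_eq_iff)
  finally show ?thesis .
qed

lemma test_field_in_test_fields:
  assumes "\<epsilon> > 0" and "0 < r" "r < s" "s < R"
  shows "test_field \<epsilon> r s \<in> test_fields ({p. height p > 0} \<inter> ball 0 R)"
proof (rule test_fieldsI)
  have "closed {p. \<epsilon> \<le> height p}"
    by (intro closed_Collect_le continuous_on_const continuous_on_height)
  then show "compact ({p. \<epsilon> \<le> height p} \<inter> cball 0 s)"
    using compact_cball by (metis Int_commute compact_Int_closed)
  show "norm (test_field \<epsilon> r s p) \<le> 1" for p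
  proof (cases "height p > 0")
    case True
    have "\<bar>cutoff \<epsilon> p * radial_cutoff r s p\<bar> \<le> 1"
      unfolding cutoff_def radial_cutoff_def abs_mult
      by (intro mult_le_one) (auto simp: smoothstep_bounds abs_le_iff intro: order_trans[OF _ smoothstep_bounds(1)])
    then show ?thesis
      using norm_calibration_le_1[OF True] unfolding test_field_def norm_minus_cancel norm_scaleR
      by (intro mult_le_one) auto
  next
    case False
    then show ?thesis using cutoff_eq_0[of \<epsilon> p] assms by (simp add: test_field_def)
  qed
qed (use assms C1_on_test_field test_field_eq_0 in \<open>auto\<close>)

text \<open>Where the radial cutoff is 1 the product rule leaves two terms: the cutoff times the
  divergence of the calibration, and the derivative of the cutoff along the calibration. Both are
  nonnegative multiples of \<open>p \<bullet> e\<close> before the minus sign.\<close>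

lemma divergence_test_field_sign:
  assumes "\<epsilon> > 0" and "0 < r" "r < s" and "norm p < r"
  shows "\<exists>m\<ge>0. divergence (test_field \<epsilon> r s) p = - m * (p \<bullet> e)"
proof (cases "height p > 0")
  case False
  have "closed {p. \<epsilon> \<le> height p}"
    by (intro closed_Collect_le continuous_on_const continuous_on_height)
  then have "divergence (test_field \<epsilon> r s) p = 0"
    using False assms cutoff_eq_0
    by (intro divergence_eq_0_outside[OF C1_on_test_field[OF assms(1)]]) (auto simp: test_field_def)
  then show ?thesis by (intro exI[of _ 0]) simp
next
  case True
  note pos = inside[OF True]
  obtain Y' where Y': "(calibration has_derivative Y') (at p)"
    by (rule C1_onE[OF C1_on_calibration]) (use True in auto)
  define d where "d = 4 * max 0 (1 - (max 0 (height p / \<epsilon> - 1))\<^sup>2) * max 0 (height p / \<epsilon> - 1)"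
  have d: "d \<ge> 0" unfolding d_def by (rule smoothstep_derivative_nonneg)
  have "((\<lambda>q. height q / \<epsilon> - 1) has_derivative (\<lambda>v. (v \<bullet> k - c * (p \<bullet> v / norm p)) / \<epsilon>)) (at p)"
    using has_derivative_diff[OF has_derivative_mult_left[OF height_has_derivative[OF pos(4)], of "1 / \<epsilon>"]
      has_derivative_const[of 1]] by simp
  from has_derivative_compose[OF this smoothstep_has_real_derivative[unfolded has_field_derivative_def]]
  have dc: "(cutoff \<epsilon> has_derivative (\<lambda>v. d * ((v \<bullet> k - c * (p \<bullet> v / norm p)) / \<epsilon>))) (at p)"
    unfolding cutoff_def[abs_def] d_def .
  have dm: "((\<lambda>q. - cutoff \<epsilon> q) has_derivative (\<lambda>v. - (d * ((v \<bullet> k - c * (p \<bullet> v / norm p)) / \<epsilon>)))) (at p)"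
    by (rule has_derivative_minus[OF dc])
  have "divergence (test_field \<epsilon> r s) p = divergence (\<lambda>q. (- cutoff \<epsilon> q) *\<^sub>R calibration q) p"
  \<comment> \<open>On this open ball the radial cutoff is identically 1, so its derivative does not
    enter.\<close>
  proof (rule divergence_transform[of _ _ "ball 0 r"])
    show "(\<lambda>q. (- cutoff \<epsilon> q) *\<^sub>R calibration q) differentiable (at p)"
      by (rule differentiableI[OF has_derivative_scaleR[OF dm Y']])
  qed (use assms radial_cutoff_eq_1 in \<open>auto simp: test_field_def\<close>)
  also have "\<dots> = - (cutoff \<epsilon> p * divergence calibration p +
      d * ((calibration p \<bullet> k - c * (p \<bullet> calibration p / norm p)) / \<epsilon>))"
    by (subst divergence_scaleR[OF dm differentiableI[OF Y']]) simp
  finally have div_eq: "divergence (test_field \<epsilon> r s) p = - (cutoff \<epsilon> p * divergence calibration p +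
      d * ((calibration p \<bullet> k - c * (p \<bullet> calibration p / norm p)) / \<epsilon>))" .
  \<comment> \<open>\<open>A\<close> and \<open>B\<close> are the coefficients of
    \<open>p \<bullet> e\<close> in the divergence of the calibration and in the derivative of
    \<open>height\<close> along it; \<open>B\<close> is nonnegative by \<open>c_le\<close>.\<close>
  define A where "A = damping p * (\<alpha> * (1 + \<alpha>)) / Q p * ((p \<bullet> e)\<^sup>2 / Q p) * (2 + \<alpha> + (1 + \<alpha>) * (p \<bullet> k / norm p))"
  define B where "B = damping p * (\<alpha> - c * (1 + \<alpha>)) / norm p"
  have damp: "damping p > 0" by (simp add: damping_def)
  have "0 \<le> A"
    unfolding A_def using damp \<alpha>_pos pos by (intro mult_nonneg_nonneg divide_nonneg_pos add_nonneg_nonneg) auto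
  moreover have "0 \<le> B"
    unfolding B_def using damp c_le pos by (intro mult_nonneg_nonneg divide_nonneg_pos) auto
  moreover have "0 \<le> cutoff \<epsilon> p" unfolding cutoff_def by (rule smoothstep_bounds)
  ultimately have "0 \<le> cutoff \<epsilon> p * A + d * B / \<epsilon>"
    using d assms(1) by (intro add_nonneg_nonneg mult_nonneg_nonneg divide_nonneg_pos)
  moreover have "divergence (test_field \<epsilon> r s) p = - (cutoff \<epsilon> p * A + d * B / \<epsilon>) * (p \<bullet> e)"
    unfolding div_eq divergence_calibration[OF True, folded A_def] height_derivative_calibration[OF True, folded B_def]
    by (simp add: algebra_simps)
  ultimately show ?thesis by blast
qed

end

section \<open>Minimality\<close>

lemma test_fields_support:
  assumes "\<phi> \<in> test_fields V"
  obtains K where "compact K" and "K \<subseteq> V" and "\<And>x. x \<notin> K \<Longrightarrow> \<phi> x = 0"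
proof
  show "compact (closure {x. \<phi> x \<noteq> 0})" "closure {x. \<phi> x \<noteq> 0} \<subseteq> V"
    using assms by (simp_all add: test_fields_def compactly_contained_def)
  show "\<phi> x = 0" if "x \<notin> closure {x. \<phi> x \<noteq> 0}" for x
    using that closure_subset[of "{x. \<phi> x \<noteq> 0}"] by auto
qed

lemma set_integrable_divergence:
  fixes \<phi> :: "'a::euclidean_space \<Rightarrow> 'a"
  assumes "C1_on UNIV \<phi>" and "compact K" and "\<And>x. x \<notin> K \<Longrightarrow> \<phi> x = 0" and "F \<in> sets lebesgue"
  shows "set_integrable lebesgue F (divergence \<phi>)"
proof -
  have "continuous_on UNIV (divergence \<phi>)"
    by (rule C1_on_divergence_continuous[OF assms(1)])
  moreover have "divergence \<phi> x = 0" if "x \<notin> K" for x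
    using divergence_eq_0_outside[OF assms(1) compact_imp_closed[OF assms(2)] assms(3) that] .
  ultimately have "integrable lborel (divergence \<phi>)"
    by (rule integrable_continuous_compact_support[OF _ assms(2)])
  then have "integrable lebesgue (divergence \<phi>)"
    by (simp add: integrable_completion)
  then show ?thesis
    unfolding set_integrable_def by (rule integrable_mult_indicator[OF assms(4)])
qed

text \<open>Apply the one-sided divergence theorem to the difference of the fields. The outer normal
  is \<open>- e\<close>, so the smaller \<open>e\<close>-component on the hyperplane gives the
  larger integral.\<close>

lemma half_space_set_integral_divergence_mono:
  fixes \<phi> \<psi> :: "'a::euclidean_space \<Rightarrow> 'a"
  assumes \<phi>: "C1_on UNIV \<phi>" "compact K" "\<And>x. x \<notin> K \<Longrightarrow> \<phi> x = 0"
    and \<psi>: "C1_on UNIV \<psi>" "compact L" "\<And>x. x \<notin> L \<Longrightarrow> \<psi> x = 0"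
    and e: "e \<in> Basis" and le: "\<And>x. x \<bullet> e = 0 \<Longrightarrow> \<phi> x \<bullet> e \<le> \<psi> x \<bullet> e"
  shows "set_lebesgue_integral lebesgue {x. x \<bullet> e > 0} (divergence \<psi>)
    \<le> set_lebesgue_integral lebesgue {x. x \<bullet> e > 0} (divergence \<phi>)"
proof -
  let ?E = "{x. x \<bullet> e > 0}"
  have diff: "\<phi> differentiable (at x)" "\<psi> differentiable (at x)" for x
    by (rule C1_onE[OF \<phi>(1)], auto simp: differentiable_def) (rule C1_onE[OF \<psi>(1)], auto simp: differentiable_def)
  have C1: "C1_on UNIV (\<lambda>x. \<phi> x - \<psi> x)"
    by (intro C1_on_diff \<phi> \<psi>)
  have supp: "compact (K \<union> L)" "\<And>x. x \<notin> K \<union> L \<Longrightarrow> \<phi> x - \<psi> x = 0"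
    using \<phi> \<psi> by auto
  have [measurable]: "divergence (\<lambda>x. \<phi> x - \<psi> x) \<in> borel_measurable borel"
    by (intro borel_measurable_continuous_onI C1_on_divergence_continuous C1)
  have "0 \<le> (\<integral>x. indicator ?E x * divergence (\<lambda>x. \<phi> x - \<psi> x) x \<partial>lborel)"
    using le by (intro half_space_integral_divergence_nonneg[OF C1 supp e]) (auto simp: inner_diff_left)
  \<comment> \<open>Borel integrands have the same integral with respect to \<open>lborel\<close>
    and its completion.\<close>
  also have "\<dots> = set_lebesgue_integral lebesgue ?E (divergence (\<lambda>x. \<phi> x - \<psi> x))"
    unfolding set_lebesgue_integral_def by (simp add: integral_completion)
  also have "divergence (\<lambda>x. \<phi> x - \<psi> x) = (\<lambda>x. divergence \<phi> x - divergence \<psi> x)"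
  proof
    fix x
    have "divergence (\<lambda>x. (\<phi> x - \<psi> x) + \<psi> x) x = divergence (\<lambda>x. \<phi> x - \<psi> x) x + divergence \<psi> x"
      by (intro divergence_add differentiable_diff diff)
    then show "divergence (\<lambda>x. \<phi> x - \<psi> x) x = divergence \<phi> x - divergence \<psi> x"
      by simp
  qed
  also have "set_lebesgue_integral lebesgue ?E (\<lambda>x. divergence \<phi> x - divergence \<psi> x) =
      set_lebesgue_integral lebesgue ?E (divergence \<phi>) - set_lebesgue_integral lebesgue ?E (divergence \<psi>)"
    by (intro set_integral_diff set_integrable_divergence[OF \<phi>] set_integrable_divergence[OF \<psi>]) simp_all
  finally show ?thesis by simp
qed

section \<open>Comparison of the half-space with a competitor\<close>

context cone_calibration
begin

text \<open>Each test field \<psi> is dominated by a truncated calibration \<phi> adapted to it: the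
  integral of div \<psi> over the half-space is at most that of div \<phi>, which does not decrease
  on passing to \<open>F\<close>. Taking the supremum over \<psi> compares the variations without
  computing either.\<close>

lemma half_space_minimizer: "perimeter_minimizer {p. height p > 0} {p. p \<bullet> e > 0}"
  unfolding perimeter_minimizer_def
proof (intro allI impI)
  fix F :: "'a set" and R :: real
  let ?E = "{p :: 'a. p \<bullet> e > 0}" and ?V = "{p. height p > 0} \<inter> ball 0 R"
  assume F: "locally_finite_perimeter F" and R: "R > 0" and EF: "sym_diff ?E F \<subset>\<subset> ball 0 R"
  have F: "F \<in> sets lebesgue" using F by (simp add: locally_finite_perimeter_def)
  have "open ?V"
    by (intro open_Int open_Collect_less continuous_on_const continuous_on_height) simp
  moreover have "variation ?E ?V \<le> variation F ?V"
    unfolding variation_def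
  proof (rule SUP_least)
    fix \<psi> assume \<psi>: "\<psi> \<in> test_fields ?V"
    obtain L where L: "compact L" "L \<subseteq> ?V" "\<And>x. x \<notin> L \<Longrightarrow> \<psi> x = 0"
      using test_fields_support[OF \<psi>] by metis
    have "compact (L \<union> closure (sym_diff ?E F))" "L \<union> closure (sym_diff ?E F) \<subseteq> ball 0 R"
      using L EF by (auto simp: compactly_contained_def)
    \<comment> \<open>One radius for both purposes: the radial cutoff must be 1 on the support of
      \<psi> and on the symmetric difference.\<close>
    then obtain r where r: "0 < r" "r < R" "L \<union> closure (sym_diff ?E F) \<subseteq> ball 0 r"
      using compact_subset_ball_shrink R by metis
    \<comment> \<open>With cutoff parameter \<delta> / 2 the height cutoff equals 1 from height
      \<delta> on, hence on all of \<open>L\<close>.\<close>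
    obtain \<delta> where \<delta>: "\<delta> > 0" "\<And>x. x \<in> L \<Longrightarrow> height x \<ge> \<delta>"
      using compact_pos_lower_bound[OF L(1) continuous_on_height] L(2) by blast
    obtain s where s: "r < s" "s < R"
      using r dense by blast
    define \<phi> where "\<phi> = test_field (\<delta> / 2) r s"
    have \<epsilon>: "\<delta> / 2 > 0" using \<delta> by simp
    have \<phi>: "\<phi> \<in> test_fields ?V"
      unfolding \<phi>_def by (rule test_field_in_test_fields[OF \<epsilon> r(1) s])
    obtain K where K: "compact K" "\<And>x. x \<notin> K \<Longrightarrow> \<phi> x = 0"
      using test_fields_support[OF \<phi>] by metis
    \<comment> \<open>On \<open>L\<close> the left side is -1, the least value possible for a
      component of a field of norm at most 1; off \<open>L\<close> the right side is 0 and the left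
      side is nonpositive.\<close>
    have le: "\<phi> x \<bullet> e \<le> \<psi> x \<bullet> e" if "x \<bullet> e = 0" for x
    proof -
      have \<phi>e: "\<phi> x \<bullet> e = - (cutoff (\<delta> / 2) x * radial_cutoff r s x)"
        by (simp add: \<phi>_def test_field_def calibration_on_hyperplane[OF that])
      show ?thesis
      proof (cases "x \<in> L")
        case True
        then have "norm x \<le> r" "height x \<ge> 2 * (\<delta> / 2)" using r \<delta> by auto
        then have "\<phi> x \<bullet> e = - 1"
          unfolding \<phi>e using cutoff_eq_1[OF \<epsilon>] radial_cutoff_eq_1[OF r(1) s(1)] by simp
        moreover have "\<bar>\<psi> x \<bullet> e\<bar> \<le> 1"
          using Basis_le_norm[OF e, of "\<psi> x"] \<psi> by (auto simp: test_fields_def intro: order_trans)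
        ultimately show ?thesis by linarith
      next
        case False
        then show ?thesis
          unfolding \<phi>e using L(3) by (simp add: cutoff_def radial_cutoff_def smoothstep_bounds)
      qed
    qed
    have "set_lebesgue_integral lebesgue ?E (divergence \<psi>) \<le> set_lebesgue_integral lebesgue ?E (divergence \<phi>)"
      by (rule half_space_set_integral_divergence_mono[OF test_fields_C1_on[OF \<phi>] K test_fields_C1_on[OF \<psi>] L(1,3) e le])
    also have "\<dots> \<le> set_lebesgue_integral lebesgue F (divergence \<phi>)"
    proof -
      \<comment> \<open>Points of the half-space outside \<open>F\<close> have div \<phi> \<le> 0
        and points of \<open>F\<close> outside the half-space have div \<phi> \<ge> 0, so both
        losing the former and gaining the latter increase the integral.\<close>
      have pointwise: "indicator ?E p * divergence \<phi> p \<le> indicator F p * divergence \<phi> p" for p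
      proof (cases "p \<in> ?E \<longleftrightarrow> p \<in> F")
        case False
        then have "p \<in> closure (sym_diff ?E F)"
          using False by (intro closure_subset[THEN subsetD]) auto
        then have "norm p < r" using r by auto
        then obtain m where "m \<ge> 0" "divergence \<phi> p = - m * (p \<bullet> e)"
          using divergence_test_field_sign[OF \<epsilon> r(1) s(1)] unfolding \<phi>_def by blast
        with False show ?thesis
          by (auto simp: indicator_def mult_nonneg_nonpos)
      qed (auto simp: indicator_def)
      have "?E \<in> sets lebesgue" by simp
      then have "set_integrable lebesgue ?E (divergence \<phi>)" "set_integrable lebesgue F (divergence \<phi>)"
        using set_integrable_divergence[OF test_fields_C1_on[OF \<phi>] K] F by blast+
      then show ?thesis
        unfolding set_lebesgue_integral_def set_integrable_def using pointwise
        by (intro integral_mono) auto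
    qed
    finally have "ereal (set_lebesgue_integral lebesgue ?E (divergence \<psi>)) \<le>
        ereal (set_lebesgue_integral lebesgue F (divergence \<phi>))"
      by simp
    also have "\<dots> \<le> (SUP \<phi>\<in>test_fields ?V. ereal (set_lebesgue_integral lebesgue F (divergence \<phi>)))"
      using \<phi> by (rule SUP_upper)
    finally show "ereal (set_lebesgue_integral lebesgue ?E (divergence \<psi>)) \<le>
        (SUP \<phi>\<in>test_fields ?V. ereal (set_lebesgue_integral lebesgue F (divergence \<phi>)))" .
  qed
  ultimately show "perimeter ?E ?V \<le> perimeter F ?V"
    by (simp add: perimeter_open)
qed

end

section \<open>The circular cone and the bound on its opening\<close>

theorem theorem1p1:
  fixes i :: "'n::finite" and l :: real
  assumes "CARD('n) \<ge> 4"
    and "0 < l" and "l \<le> lambda_bar CARD('n)"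
  shows "perimeter_minimizer (circular_cone l) (half_space i)"
proof -
  define n where "n = real CARD('n)"
  \<comment> \<open>Normalizing by \<open>q\<close> turns the slope \<open>l\<close> relative to the
    horizontal norm into the slope c = \<open>l / q\<close> relative to the full norm.\<close>
  define q where "q = sqrt (1 + l\<^sup>2)"
  let ?e = "(axis i 1, 0) :: (real ^ 'n) \<times> real" and ?k = "(0, 1) :: (real ^ 'n) \<times> real"
  have n: "n \<ge> 4" using assms(1) by (simp add: n_def)
  have q: "q > 0" "q\<^sup>2 = 1 + l\<^sup>2"
    by (simp_all add: q_def add_pos_nonneg)
  have "l * (2 * sqrt (n - 2)) \<le> n - 3"
    using assms(3) n by (simp add: lambda_bar_def n_def[symmetric] pos_le_divide_eq field_simps)
  then have "(l * (2 * sqrt (n - 2)))\<^sup>2 \<le> (n - 3)\<^sup>2"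
    using assms(2) n by (intro power_mono) auto
  then have *: "4 * (n - 2) * l\<^sup>2 \<le> (n - 3)\<^sup>2"
    using n by (simp add: power_mult_distrib mult_ac)
  \<comment> \<open>The identity (n - 1)^2 = (n - 3)^2 + 4 (n - 2) converts the bound on
    \<open>l\<close> into l (n - 1) \<le> (n - 3) q, which is \<open>c_le\<close> because 1 +
    \<alpha> = (n - 1) / 2.\<close>
  have "(l * (n - 1))\<^sup>2 = (n - 3)\<^sup>2 * l\<^sup>2 + 4 * (n - 2) * l\<^sup>2"
    by (simp add: power2_eq_square algebra_simps)
  also have "\<dots> \<le> (n - 3)\<^sup>2 * l\<^sup>2 + (n - 3)\<^sup>2"
    using * by simp
  also have "\<dots> = ((n - 3) * q)\<^sup>2"
    unfolding power_mult_distrib q(2) by (simp add: distrib_left)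
  finally have "l * (n - 1) \<le> (n - 3) * q"
    by (rule power2_le_imp_le) (use n q in simp)
  then have c_le: "l / q * (1 + (n - 3) / 2) \<le> (n - 3) / 2"
    using q by (simp add: field_simps)
  interpret cone_calibration ?e ?k "l / q" "(n - 3) / 2"
  proof
    show "?e \<in> Basis" "?k \<in> Basis"
      by (auto simp: Basis_prod_def Basis_vec_def)
    show "?e \<noteq> ?k" by simp
    show "0 < (n - 3) / 2" using n by simp
    show "real DIM((real ^ 'n) \<times> real) = 2 * ((n - 3) / 2) + 4"
      by (simp add: n_def field_simps)
    show "0 < l / q" using assms(2) q by simp
  qed (rule c_le)
  have "half_space i = {p. p \<bullet> ?e > 0}"
    by (auto simp: half_space_def inner_axis)
  moreover have "circular_cone l = {p. height p > 0}"
  proof -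
    have "l * norm x < t \<longleftrightarrow> l / q * norm (x, t) < t" for x :: "real ^ 'n" and t
    proof (cases "t > 0")
      case True
      have "l * norm x < t \<longleftrightarrow> (l * norm x)\<^sup>2 < t\<^sup>2"
        using True assms(2) abs_le_square_iff[of t "l * norm x"] by (simp add: linorder_not_le[symmetric])
      \<comment> \<open>Adding l^2 t^2 to both sides completes the horizontal norm to the full
        one.\<close>
      also have "\<dots> \<longleftrightarrow> (l * norm (x, t))\<^sup>2 < (t * q)\<^sup>2"
        by (simp add: norm_prod_def power_mult_distrib q(2) algebra_simps)
      also have "\<dots> \<longleftrightarrow> l * norm (x, t) < t * q"
        using True assms(2) q abs_le_square_iff[of "t * q" "l * norm (x, t)"] by (simp add: linorder_not_le[symmetric])
      also have "\<dots> \<longleftrightarrow> l / q * norm (x, t) < t"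
        using q by (simp add: field_simps)
      finally show ?thesis .
    next
      case False
      have "0 \<le> l * norm x" "0 \<le> l / q * norm (x, t)"
        using assms(2) q by simp_all
      with False show ?thesis by linarith
    qed
    then show ?thesis
      by (auto simp: circular_cone_def height_def)
  qed
  ultimately show ?thesis
    using half_space_minimizer by simp
qed

end
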